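(* Let $\Delta$ be a pure two-dimensional simplicial complex on $6$ vertices. Then the following are equivalent: (a) $I_\Delta^{(m)}=I_\Delta^m$ for some $m\ge 3$; (b) $I_\Delta^{(m)}=I_\Delta^m$ for all $m\ge 1$; (c) $\overline{\Delta_1}$ contains three pairwise disjoint edges and $\Delta_1$ contains two disjoint triangles.
   Context: Let $K$ be a field and $R=K[x_1,\dots,x_n]$. A simplicial complex $\Delta$ on the vertex set $[n]=\{1,\dots,n\}$ is assumed to satisfy $\{i\}\in\Delta$ for every $i\in[n]$. A facet is a maximal face; $\mathcal F(\Delta)$ is the set of facets; $\Delta$ is pure if all facets have the same dimension. The Stanley-Reisner ideal is $I_\Delta=(x_{i_1}\cdots x_{i_s} : \{i_1,\dots,i_s\}\notin\Delta)$. The $m$-th symbolic power is $I_\Delta^{(m)}=\bigcap_{F\in\mathcal F(\Delta)}P_F^m$, where $P_F=(x_i : i\notin F)$. $\Delta_1$ denotes the graph on $[n]$ whose edges are the two-element faces of $\Delta$, and $\overline{\Delta_1}$ is its complement graph on $[n]$. A triangle of $\Delta_1$ is a set of three pairwise adjacent vertices of $\Delta_1$ (it need not be a face of $\Delta$). Disjoint means having no common vertex. *)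

theory Defs
  imports Complex_Main "HOL-Library.Poly_Mapping" "HOL-Library.Numeral_Type"
begin

section \<open>Ideals in a commutative ring\<close>

text \<open>Ideals are the submodules of a ring over itself, so \<open>ideal.span S\<close> is the ideal
  generated by \<open>S\<close>.\<close>

interpretation ideal: module "(*) :: 'a::comm_ring_1 \<Rightarrow> 'a \<Rightarrow> 'a"
  by standard (simp_all add: algebra_simps)

definition ideal_prod :: "'a::comm_ring_1 set \<Rightarrow> 'a set \<Rightarrow> 'a set" where
  "ideal_prod I J = ideal.span {a * b | a b. a \<in> I \<and> b \<in> J}"

primrec ideal_power :: "'a::comm_ring_1 set \<Rightarrow> nat \<Rightarrow> 'a set" where
  "ideal_power I 0 = UNIV"
| "ideal_power I (Suc m) = ideal_prod I (ideal_power I m)"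

section \<open>Simplicial complexes and graphs\<close>

text \<open>The vertex set is all of the finite type \<open>'v\<close>; its cardinality plays the role of \<open>n\<close>.\<close>

definition simplicial_complex :: "'v::finite set set \<Rightarrow> bool" where
  "simplicial_complex \<Delta> \<longleftrightarrow> (\<forall>F\<in>\<Delta>. \<forall>G\<subseteq>F. G \<in> \<Delta>) \<and> (\<forall>i. {i} \<in> \<Delta>)"

definition facets :: "'v::finite set set \<Rightarrow> 'v set set" where
  "facets \<Delta> = {F \<in> \<Delta>. \<forall>G\<in>\<Delta>. F \<subseteq> G \<longrightarrow> G = F}"

definition face_dim :: "'v::finite set \<Rightarrow> int" where
  "face_dim F = int (card F) - 1"

definition complex_dim :: "'v::finite set set \<Rightarrow> int" where
  "complex_dim \<Delta> = Max (face_dim ` \<Delta>)"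

definition pure :: "'v::finite set set \<Rightarrow> bool" where
  "pure \<Delta> \<longleftrightarrow> (\<forall>F\<in>facets \<Delta>. \<forall>G\<in>facets \<Delta>. face_dim F = face_dim G)"

text \<open>A simple graph on \<open>'v\<close> is given by its set of edges, which are two-element sets.\<close>

definition graph_of :: "'v::finite set set \<Rightarrow> 'v set set" where
  "graph_of \<Delta> = {e \<in> \<Delta>. card e = 2}"

definition complement_graph :: "'v::finite set set \<Rightarrow> 'v set set" where
  "complement_graph E = {e. card e = 2 \<and> e \<notin> E}"

definition triangles :: "'v::finite set set \<Rightarrow> 'v set set" where
  "triangles E = {T. card T = 3 \<and> (\<forall>u\<in>T. \<forall>v\<in>T. u \<noteq> v \<longrightarrow> {u, v} \<in> E)}"

section \<open>Stanley--Reisner ideals and their symbolic powers\<close>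

text \<open>The polynomial ring over \<open>'k\<close> in the variables \<open>x\<^sub>i\<close>, \<open>i :: 'v\<close>: finitely supported
  functions from exponent vectors to coefficients, with convolution as multiplication.\<close>

type_synonym ('v, 'k) mpoly = "('v \<Rightarrow>\<^sub>0 nat) \<Rightarrow>\<^sub>0 'k"

definition var :: "'v \<Rightarrow> ('v, 'k::field) mpoly" where
  "var i = Poly_Mapping.single (Poly_Mapping.single i 1) 1"

definition stanley_reisner_ideal :: "'v::finite set set \<Rightarrow> ('v, 'k::field) mpoly set" where
  "stanley_reisner_ideal \<Delta> = ideal.span {\<Prod>i\<in>S. var i | S. S \<notin> \<Delta>}"

definition facet_prime :: "'v::finite set \<Rightarrow> ('v, 'k::field) mpoly set" where
  "facet_prime F = ideal.span {var i | i. i \<notin> F}"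

definition symbolic_power :: "'v::finite set set \<Rightarrow> nat \<Rightarrow> ('v, 'k::field) mpoly set" where
  "symbolic_power \<Delta> m = (\<Inter>F\<in>facets \<Delta>. ideal_power (facet_prime F) m)"

end

theory Submission imports Defs begin

text \<open>All ideals are monomial, so \<open>I\<^sup>(\<^sup>m\<^sup>) = I\<^sup>m\<close> says that every \<open>v : [n] \<rightarrow> \<nat>\<close> whose sum over the complement of each
  facet is at least \<open>m\<close> dominates the sum of the indicators of \<open>m\<close> nonfaces. Nonfaces have at least two
  elements, so exponents of degree at most \<open>2m\<close> are decisive.

  Necessity: write \<open>m = 3k + r\<close> with \<open>k \<ge> 1\<close>. The exponent \<open>k\<close> on all vertices plus \<open>r\<close> on a nonedge has
  degree \<open>2m\<close>, so it must decompose into nonedges; this yields Hall's condition for the nonedges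
  between a facet and its complement, hence three disjoint nonedges, and all triangles are transversals
  of them. Without two disjoint triangles all facets differ from a fixed transversal in at most one
  vertex, and weight about \<open>m / 2\<close> on the opposite transversal gives an exponent of degree below \<open>2m\<close>.

  Sufficiency: if the bounds hold for all triangles of the 1-skeleton and not only for the facets,
  Koenig's theorem for the nonedges between the two disjoint triangles decomposes \<open>v\<close>. Otherwise
  the bound fails for a triangle that is not a face, and copies of this nonface together with the three
  disjoint nonedges decompose \<open>v\<close>.\<close>

section \<open>Monomial ideals\<close>

text \<open>For arbitrary \<open>U\<close> this is the linear span of the monomials with exponent in
  \<open>U\<close>; it is an ideal once \<open>up_closed U\<close> holds.\<close>

definition monomial_ideal :: "('v \<Rightarrow>\<^sub>0 nat) set \<Rightarrow> ('v, 'k::field) mpoly set" where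
  "monomial_ideal U = {f. Poly_Mapping.keys f \<subseteq> U}"

definition up_closed :: "('v \<Rightarrow>\<^sub>0 nat) set \<Rightarrow> bool" where
  "up_closed U \<longleftrightarrow> (\<forall>t\<in>U. \<forall>s. s + t \<in> U)"

lemma subspace_monomial_ideal:
  assumes "up_closed U"
  shows "ideal.subspace (monomial_ideal U :: ('v, 'k::field) mpoly set)"
proof (rule ideal.subspaceI)
  fix f g :: "('v, 'k) mpoly"
  show "f + g \<in> monomial_ideal U" if "f \<in> monomial_ideal U" "g \<in> monomial_ideal U"
    using that keys_add[of f g] by (auto simp: monomial_ideal_def)
  show "g * f \<in> monomial_ideal U" if "f \<in> monomial_ideal U"
    using that keys_mult[of g f] assms
    unfolding monomial_ideal_def up_closed_def by blast
qed (simp add: monomial_ideal_def)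

lemma sum_single_lookup:
  "(\<Sum>t\<in>Poly_Mapping.keys f. Poly_Mapping.single t (Poly_Mapping.lookup f t)) = f"
  by (rule poly_mapping_eqI)
    (simp add: lookup_sum lookup_single when_def in_keys_iff sum.delta)

lemma monomial_ideal_subset_span:
  assumes "\<And>t c. t \<in> U \<Longrightarrow> Poly_Mapping.single t c \<in> ideal.span B"
  shows "monomial_ideal U \<subseteq> ideal.span B"
proof
  fix f :: "('a, 'b) mpoly"
  assume "f \<in> monomial_ideal U"
  then have "(\<Sum>t\<in>Poly_Mapping.keys f. Poly_Mapping.single t (Poly_Mapping.lookup f t)) \<in> ideal.span B"
    by (intro ideal.span_sum assms) (auto simp: monomial_ideal_def)
  then show "f \<in> ideal.span B"
    by (simp only: sum_single_lookup)
qed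

lemma span_monomials:
  "ideal.span ((\<lambda>t. Poly_Mapping.single t 1) ` G) =
     (monomial_ideal {s + g | s g. g \<in> G} :: ('v, 'k::field) mpoly set)"
proof
  have "up_closed {s + g | s g. g \<in> G}"
    unfolding up_closed_def by (blast intro: add.assoc[symmetric])
  moreover have "g \<in> {s + g | s g. g \<in> G}" if "g \<in> G" for g
    using that by (auto intro: exI[of _ 0])
  ultimately show "ideal.span ((\<lambda>t. Poly_Mapping.single t 1) ` G) \<subseteq>
      (monomial_ideal {s + g | s g. g \<in> G} :: ('v, 'k) mpoly set)"
    by (intro ideal.span_minimal subspace_monomial_ideal) (auto simp: monomial_ideal_def)
  have "Poly_Mapping.single (s + g) c \<in> ideal.span ((\<lambda>t. Poly_Mapping.single t (1::'k)) ` G)"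
    if "g \<in> G" for s g c
  proof -
    have "Poly_Mapping.single (s + g) c = Poly_Mapping.single s c * Poly_Mapping.single g (1::'k)"
      by (simp add: mult_single)
    then show ?thesis
      using that by (auto intro: ideal.span_scale ideal.span_base)
  qed
  then show "monomial_ideal {s + g | s g. g \<in> G} \<subseteq>
      ideal.span ((\<lambda>t. Poly_Mapping.single t (1::'k)) ` G)"
    by (intro monomial_ideal_subset_span) auto
qed

text \<open>A shift of \<open>s + t\<close> is absorbed by \<open>s\<close>, so the sumset is
  up-closed; each term over it factors into a term from either side.\<close>

lemma ideal_prod_monomial_ideal:
  assumes "up_closed U"
  shows "ideal_prod (monomial_ideal U) (monomial_ideal V) =
    (monomial_ideal {s + t | s t. s \<in> U \<and> t \<in> V} :: ('v, 'k::field) mpoly set)"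
    (is "_ = monomial_ideal ?W")
proof
  have "up_closed ?W"
    using assms unfolding up_closed_def by (blast intro: add.assoc[symmetric])
  moreover have "f * g \<in> monomial_ideal ?W"
    if "f \<in> monomial_ideal U" "g \<in> monomial_ideal V" for f g :: "('v, 'k) mpoly"
    using that keys_mult[of f g] unfolding monomial_ideal_def by blast
  ultimately show "ideal_prod (monomial_ideal U) (monomial_ideal V) \<subseteq>
      (monomial_ideal ?W :: ('v, 'k) mpoly set)"
    unfolding ideal_prod_def by (intro ideal.span_minimal subspace_monomial_ideal) auto
  have "Poly_Mapping.single (s + t) c \<in> (ideal_prod (monomial_ideal U) (monomial_ideal V) :: ('v, 'k) mpoly set)"
    if "s \<in> U" "t \<in> V" for s t c
  proof -
    have "Poly_Mapping.single (s + t) c = Poly_Mapping.single s c * Poly_Mapping.single t (1::'k)"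
      by (simp add: mult_single)
    moreover have "Poly_Mapping.single s c \<in> monomial_ideal U"
      "Poly_Mapping.single t (1::'k) \<in> monomial_ideal V"
      using that by (auto simp: monomial_ideal_def)
    ultimately show ?thesis
      unfolding ideal_prod_def by (intro ideal.span_base) blast
  qed
  then show "(monomial_ideal ?W :: ('v, 'k) mpoly set) \<subseteq> ideal_prod (monomial_ideal U) (monomial_ideal V)"
    unfolding ideal_prod_def by (intro monomial_ideal_subset_span) auto
qed

lemma monomial_ideal_eq_iff:
  "(monomial_ideal U :: ('v, 'k::field) mpoly set) = monomial_ideal V \<longleftrightarrow> U = V"
proof
  have "t \<in> U \<longleftrightarrow> Poly_Mapping.single t (1::'k) \<in> monomial_ideal U" for t and U :: "('v \<Rightarrow>\<^sub>0 nat) set"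
    by (simp add: monomial_ideal_def)
  then show "U = V" if "(monomial_ideal U :: ('v, 'k) mpoly set) = monomial_ideal V"
    using that by blast
qed simp

lemma prod_var:
  assumes "finite S"
  shows "(\<Prod>i\<in>S. var i) = (Poly_Mapping.single (\<Sum>i\<in>S. Poly_Mapping.single i 1) 1 :: ('v, 'k::field) mpoly)"
  using assms by induction (simp_all add: var_def mult_single)

section \<open>The exponents of symbolic and ordinary powers\<close>

text \<open>A list of \<open>m\<close> nonfaces witnesses that the monomial with exponent vector \<open>v\<close> is a multiple
  of a product of \<open>m\<close> squarefree generators.\<close>

definition packs :: "'v::finite set set \<Rightarrow> nat \<Rightarrow> ('v \<Rightarrow> nat) \<Rightarrow> bool" where
  "packs \<Delta> m v \<longleftrightarrow> (\<exists>Ss. length Ss = m \<and> set Ss \<inter> \<Delta> = {} \<and> (\<forall>i. (\<Sum>S\<leftarrow>Ss. of_bool (i \<in> S)) \<le> v i))"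

lemma facet_prime_monomial:
  "(facet_prime F :: ('v::finite, 'k::field) mpoly set) =
     monomial_ideal {t. 1 \<le> (\<Sum>i\<in>-F. Poly_Mapping.lookup t i)}"
proof -
  have "{var i :: ('v, 'k) mpoly | i. i \<notin> F} =
      (\<lambda>t. Poly_Mapping.single t 1) ` (\<lambda>i. Poly_Mapping.single i 1) ` (-F)"
    unfolding var_def by auto
  moreover have "(1 \<le> (\<Sum>i\<in>-F. Poly_Mapping.lookup t i)) \<longleftrightarrow> 
    (\<exists>s g. t = s + g \<and> g \<in> (\<lambda>i. Poly_Mapping.single i 1) ` (-F))" for t :: "'v \<Rightarrow>\<^sub>0 nat"
  proof
    assume "1 \<le> (\<Sum>i\<in>-F. Poly_Mapping.lookup t i)"
    then obtain i where i: "i \<in> -F" "Poly_Mapping.lookup t i \<noteq> 0"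
      by (metis not_one_le_zero sum.neutral)
    then have "t = (t - Poly_Mapping.single i 1) + Poly_Mapping.single i 1"
      by (intro poly_mapping_eqI) (auto simp: lookup_add lookup_minus lookup_single when_def)
    with i show "\<exists>s g. t = s + g \<and> g \<in> (\<lambda>i. Poly_Mapping.single i 1) ` (-F)"
      by blast
  next
    assume "\<exists>s g. t = s + g \<and> g \<in> (\<lambda>i. Poly_Mapping.single i 1) ` (-F)"
    then obtain s i where "t = s + Poly_Mapping.single i 1" "i \<in> -F" by blast
    then have "1 \<le> Poly_Mapping.lookup t i"
      by (simp add: lookup_add)
    also have "\<dots> \<le> (\<Sum>i\<in>-F. Poly_Mapping.lookup t i)"
      using \<open>i \<in> -F\<close> by (intro member_le_sum) auto
    finally show "1 \<le> (\<Sum>i\<in>-F. Poly_Mapping.lookup t i)" .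
  qed
  ultimately show ?thesis
    unfolding facet_prime_def by (simp add: span_monomials)
qed

text \<open>By induction: taking one variable outside \<open>F\<close> from a monomial of degree at
  least \<open>Suc m\<close> in those variables leaves degree at least \<open>m\<close>.\<close>

lemma ideal_power_facet_prime:
  "(ideal_power (facet_prime F) m :: ('v::finite, 'k::field) mpoly set) =
     monomial_ideal {t. m \<le> (\<Sum>i\<in>-F. Poly_Mapping.lookup t i)}"
proof (induction m)
  case 0
  show ?case by (simp add: monomial_ideal_def)
next
  case (Suc m)
  have split: "\<exists>s t. u = s + t \<and> 1 \<le> (\<Sum>i\<in>-F. Poly_Mapping.lookup s i) \<and> m \<le> (\<Sum>i\<in>-F. Poly_Mapping.lookup t i)"
    if "Suc m \<le> (\<Sum>i\<in>-F. Poly_Mapping.lookup u i)" for u :: "'v \<Rightarrow>\<^sub>0 nat"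
  proof -
    have "(\<Sum>i\<in>-F. Poly_Mapping.lookup u i) \<noteq> 0"
      using that by linarith
    then obtain i where i: "i \<in> -F" "Poly_Mapping.lookup u i \<noteq> 0"
      by (rule sum.not_neutral_contains_not_neutral)
    define t where "t = u - Poly_Mapping.single i 1"
    have u: "u = Poly_Mapping.single i 1 + t"
      using i unfolding t_def
      by (intro poly_mapping_eqI) (auto simp: lookup_add lookup_minus lookup_single when_def)
    have "(\<Sum>j\<in>-F. Poly_Mapping.lookup (Poly_Mapping.single i (1::nat)) j) = 1"
      using i by (simp add: lookup_single when_def)
    then show ?thesis
      using that u by (intro exI[of _ "Poly_Mapping.single i 1"] exI[of _ t])
         (simp add: lookup_add sum.distrib)
  qed
  have "up_closed {t. 1 \<le> (\<Sum>i\<in>-F. Poly_Mapping.lookup t i)}"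
    by (auto simp: up_closed_def lookup_add sum.distrib)
  then have "ideal_power (facet_prime F) (Suc m) = (monomial_ideal {s + t | s t.
      s \<in> {t. 1 \<le> (\<Sum>i\<in>-F. Poly_Mapping.lookup t i)} \<and> t \<in> {t. m \<le> (\<Sum>i\<in>-F. Poly_Mapping.lookup t i)}} :: ('v, 'k) mpoly set)"
    unfolding ideal_power.simps Suc
    by (simp only: facet_prime_monomial ideal_prod_monomial_ideal)
  also have "{s + t | s t. s \<in> {t. 1 \<le> (\<Sum>i\<in>-F. Poly_Mapping.lookup t i)} \<and>
      t \<in> {t. m \<le> (\<Sum>i\<in>-F. Poly_Mapping.lookup t i)}} = {t. Suc m \<le> (\<Sum>i\<in>-F. Poly_Mapping.lookup t i)}"
    by (auto simp: lookup_add sum.distrib intro: split[simplified])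
  finally show ?case .
qed

lemma lookup_sum_single:
  fixes S :: "'v::finite set"
  shows "Poly_Mapping.lookup (\<Sum>i\<in>S. Poly_Mapping.single i (1::nat)) j = of_bool (j \<in> S)"
  by (simp add: lookup_sum lookup_single when_def)

lemma stanley_reisner_ideal_monomial:
  "(stanley_reisner_ideal \<Delta> :: ('v::finite, 'k::field) mpoly set) =
     monomial_ideal {t. \<exists>S. S \<notin> \<Delta> \<and> (\<forall>i. of_bool (i \<in> S) \<le> Poly_Mapping.lookup t i)}"
proof -
  let ?e = "\<lambda>S. \<Sum>i\<in>S. Poly_Mapping.single i (1::nat)"
  have "{\<Prod>i\<in>S. var i :: ('v, 'k) mpoly | S. S \<notin> \<Delta>} = (\<lambda>t. Poly_Mapping.single t 1) ` ?e ` (-\<Delta>)"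
    by (auto simp: prod_var)
  moreover have "(\<exists>s g. t = s + g \<and> g \<in> ?e ` (-\<Delta>)) \<longleftrightarrow>
      (\<exists>S. S \<notin> \<Delta> \<and> (\<forall>i. of_bool (i \<in> S) \<le> Poly_Mapping.lookup t i))" for t
  proof
    assume "\<exists>S. S \<notin> \<Delta> \<and> (\<forall>i. of_bool (i \<in> S) \<le> Poly_Mapping.lookup t i)"
    then obtain S where S: "S \<notin> \<Delta>" "\<forall>i. of_bool (i \<in> S) \<le> Poly_Mapping.lookup t i" by blast
    have "t = (t - ?e S) + ?e S"
      using S by (intro poly_mapping_eqI) (simp add: lookup_add lookup_minus lookup_sum_single del: One_nat_def)
    with S show "\<exists>s g. t = s + g \<and> g \<in> ?e ` (-\<Delta>)" by blast
  qed (auto simp: lookup_add lookup_sum_single simp del: One_nat_def)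
  ultimately show ?thesis
    unfolding stanley_reisner_ideal_def by (simp add: span_monomials)
qed

text \<open>The recursion mirrors \<open>ideal_power\<close>: the head of the list supplies the
  factor in the ideal, the tail the factor in its power.\<close>

lemma packs_Suc:
  "packs \<Delta> (Suc m) v \<longleftrightarrow> (\<exists>s t. (\<forall>i. v i = s i + t i) \<and> (\<exists>S. S \<notin> \<Delta> \<and> (\<forall>i. of_bool (i \<in> S) \<le> s i)) \<and> packs \<Delta> m t)"
proof
  assume "packs \<Delta> (Suc m) v"
  then obtain S Ss where "length Ss = m" "S \<notin> \<Delta>" "set Ss \<inter> \<Delta> = {}"
    and le: "\<And>i. of_bool (i \<in> S) + (\<Sum>S\<leftarrow>Ss. of_bool (i \<in> S)) \<le> v i"
    unfolding packs_def by (auto simp: length_Suc_conv)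
  moreover have "(\<Sum>S\<leftarrow>Ss. of_bool (i \<in> S)) \<le> v i - of_bool (i \<in> S)"
    "v i = of_bool (i \<in> S) + (v i - of_bool (i \<in> S))" for i
    using le[of i] by linarith+
  ultimately show "\<exists>s t. (\<forall>i. v i = s i + t i) \<and> (\<exists>S. S \<notin> \<Delta> \<and> (\<forall>i. of_bool (i \<in> S) \<le> s i)) \<and> packs \<Delta> m t"
    unfolding packs_def
    by (intro exI[of _ "\<lambda>i. of_bool (i \<in> S)"] exI[of _ "\<lambda>i. v i - of_bool (i \<in> S)"]) blast
next
  assume "\<exists>s t. (\<forall>i. v i = s i + t i) \<and> (\<exists>S. S \<notin> \<Delta> \<and> (\<forall>i. of_bool (i \<in> S) \<le> s i)) \<and> packs \<Delta> m t"
  then obtain s t S Ss where "\<forall>i. v i = s i + t i" "S \<notin> \<Delta>" "\<forall>i. of_bool (i \<in> S) \<le> s i"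
    "length Ss = m" "set Ss \<inter> \<Delta> = {}" "\<forall>i. (\<Sum>S\<leftarrow>Ss. of_bool (i \<in> S)) \<le> t i"
    unfolding packs_def by blast
  moreover from this have "(\<Sum>T\<leftarrow>S # Ss. of_bool (i \<in> T)) \<le> v i" for i
    by (simp only: list.map sum_list.Cons add_mono)
  ultimately show "packs \<Delta> (Suc m) v"
    unfolding packs_def by (intro exI[of _ "S # Ss"]) simp
qed

lemma ideal_power_stanley_reisner:
  "(ideal_power (stanley_reisner_ideal \<Delta>) m :: ('v::finite, 'k::field) mpoly set) =
     monomial_ideal {t. packs \<Delta> m (Poly_Mapping.lookup t)}"
proof (induction m)
  case 0
  show ?case by (simp add: monomial_ideal_def packs_def)
next
  case (Suc m)
  let ?U = "{t. \<exists>S. S \<notin> \<Delta> \<and> (\<forall>i. of_bool (i \<in> S) \<le> Poly_Mapping.lookup t i)}"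
  have "up_closed ?U"
    unfolding up_closed_def by (auto simp: lookup_add intro: le_trans trans_le_add2)
  then have "ideal_power (stanley_reisner_ideal \<Delta>) (Suc m) = (monomial_ideal {s + t | s t.
      s \<in> ?U \<and> t \<in> {t. packs \<Delta> m (Poly_Mapping.lookup t)}} :: ('v, 'k) mpoly set)"
    unfolding ideal_power.simps Suc
    by (simp only: stanley_reisner_ideal_monomial ideal_prod_monomial_ideal)
  also have "{s + t | s t. s \<in> ?U \<and> t \<in> {t. packs \<Delta> m (Poly_Mapping.lookup t)}} =
      {t. packs \<Delta> (Suc m) (Poly_Mapping.lookup t)}"
  proof (intro set_eqI iffI)
    fix u
    assume "u \<in> {t. packs \<Delta> (Suc m) (Poly_Mapping.lookup t)}"
    then obtain s t S where u: "\<forall>i. Poly_Mapping.lookup u i = s i + t i"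
      "S \<notin> \<Delta>" "\<forall>i. of_bool (i \<in> S) \<le> s i" "packs \<Delta> m t"
      unfolding mem_Collect_eq packs_Suc by blast
    \<comment> \<open>\<open>packs_Suc\<close> yields plain functions; as \<open>'v\<close> is
      finite, each of them is the exponent vector of a monomial.\<close>
    have Abs: "Poly_Mapping.lookup (Abs_poly_mapping w) = w" for w :: "'v \<Rightarrow> nat"
      by (simp add: Abs_poly_mapping_inverse)
    have "u = Abs_poly_mapping s + Abs_poly_mapping t"
      using u(1) by (intro poly_mapping_eqI) (simp add: lookup_add Abs)
    moreover have "Abs_poly_mapping s \<in> ?U" "packs \<Delta> m (Poly_Mapping.lookup (Abs_poly_mapping t))"
      using u unfolding Abs mem_Collect_eq by blast+
    ultimately show "u \<in> {s + t | s t. s \<in> ?U \<and> t \<in> {t. packs \<Delta> m (Poly_Mapping.lookup t)}}"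
      by blast
  next
    fix u
    assume "u \<in> {s + t | s t. s \<in> ?U \<and> t \<in> {t. packs \<Delta> m (Poly_Mapping.lookup t)}}"
    then obtain s t where u: "u = s + t" "s \<in> ?U" "packs \<Delta> m (Poly_Mapping.lookup t)"
      by blast
    then show "u \<in> {t. packs \<Delta> (Suc m) (Poly_Mapping.lookup t)}"
      unfolding packs_Suc mem_Collect_eq by (metis lookup_add)
  qed
  finally show ?case .
qed

lemma symbolic_power_monomial:
  "(symbolic_power \<Delta> m :: ('v::finite, 'k::field) mpoly set) =
     monomial_ideal {t. \<forall>F\<in>facets \<Delta>. m \<le> (\<Sum>i\<in>-F. Poly_Mapping.lookup t i)}"
  unfolding symbolic_power_def ideal_power_facet_prime monomial_ideal_def by blast

lemma symbolic_power_eq_iff: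
  "(symbolic_power \<Delta> m = (ideal_power (stanley_reisner_ideal \<Delta>) m :: ('v::finite, 'k::field) mpoly set)) \<longleftrightarrow>
    (\<forall>v. (\<forall>F\<in>facets \<Delta>. m \<le> sum v (-F)) \<longleftrightarrow> packs \<Delta> m v)"
proof -
  have *: "(\<forall>t. P (Poly_Mapping.lookup t)) \<longleftrightarrow> (\<forall>v. P v)" for P :: "('v \<Rightarrow> nat) \<Rightarrow> bool"
  proof
    assume "\<forall>t. P (Poly_Mapping.lookup t)"
    then have "P (Poly_Mapping.lookup (Abs_poly_mapping v))" for v by blast
    then show "\<forall>v. P v" by (simp add: Abs_poly_mapping_inverse)
  qed blast
  show ?thesis
    unfolding symbolic_power_monomial ideal_power_stanley_reisner monomial_ideal_eq_iff
    unfolding set_eq_iff mem_Collect_eq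
    by (rule *)
qed

lemma sum_list_nonfaces_weight:
  fixes y :: "'v::finite \<Rightarrow> nat"
  shows "(\<Sum>i\<in>UNIV. y i * (\<Sum>S\<leftarrow>Ss. of_bool (i \<in> S))) = (\<Sum>S\<leftarrow>Ss. sum y S)"
proof (induction Ss)
  case (Cons S Ss)
  have "(\<Sum>i\<in>UNIV. y i * of_bool (i \<in> S)) = sum y S"
    by (simp add: of_bool_def if_distrib sum.If_cases cong: if_cong)
  with Cons show ?case
    by (simp add: distrib_left sum.distrib)
qed simp

text \<open>This is the inclusion of the ordinary in the symbolic power: no facet contains a
  nonface, so each of the \<open>m\<close> nonfaces uses up a unit of \<open>v\<close> outside
  \<open>F\<close>.\<close>

lemma packs_imp_symbolic:
  assumes "packs \<Delta> m v" "F \<in> facets \<Delta>" "simplicial_complex \<Delta>"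
  shows "m \<le> sum v (-F)"
proof -
  obtain Ss where Ss: "length Ss = m" "set Ss \<inter> \<Delta> = {}" "\<And>i. (\<Sum>S\<leftarrow>Ss. of_bool (i \<in> S)) \<le> v i"
    using assms unfolding packs_def by blast
  have "1 \<le> (\<Sum>i\<in>S. of_bool (i \<in> -F) :: nat)" if "S \<in> set Ss" for S
  proof -
    have "\<not> S \<subseteq> F"
    proof
      assume "S \<subseteq> F"
      with assms(2,3) have "S \<in> \<Delta>"
        unfolding facets_def simplicial_complex_def by blast
      with that Ss(2) show False by blast
    qed
    then obtain i where "i \<in> S" "i \<notin> F" by blast
    then have "of_bool (i \<in> -F) \<le> (\<Sum>i\<in>S. of_bool (i \<in> -F) :: nat)"
      by (intro member_le_sum) auto
    with \<open>i \<notin> F\<close> show ?thesis by simp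
  qed
  then have "(\<Sum>S\<leftarrow>Ss. 1) \<le> (\<Sum>S\<leftarrow>Ss. \<Sum>i\<in>S. of_bool (i \<in> -F) :: nat)"
    by (intro sum_list_mono) auto
  also have "\<dots> = (\<Sum>i\<in>UNIV. of_bool (i \<in> -F) * (\<Sum>S\<leftarrow>Ss. of_bool (i \<in> S)))"
    by (rule sum_list_nonfaces_weight[symmetric])
  also have "\<dots> \<le> (\<Sum>i\<in>UNIV. of_bool (i \<in> -F) * v i)"
    by (intro sum_mono mult_left_mono Ss) auto
  also have "\<dots> = sum v (-F)"
    by (intro sum.mono_neutral_cong_right) auto
  finally show ?thesis
    using Ss(1) by (simp add: sum_list_triv)
qed

section \<open>Koenig's theorem\<close>

text \<open>Keeping the two sides apart as components of pairs makes the graph bipartite by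
  construction. Finiteness is demanded because \<open>card\<close> is 0 on infinite sets, which
  would be covers at no cost.\<close>

definition edge_cover :: "('a \<times> 'b) set \<Rightarrow> 'a set \<Rightarrow> 'b set \<Rightarrow> bool" where
  "edge_cover E P Q \<longleftrightarrow> finite P \<and> finite Q \<and> (\<forall>(x, y)\<in>E. x \<in> P \<or> y \<in> Q)"

text \<open>Rado's argument: two edges at \<open>x\<close> and small covers missing one of them each would combine,
  by submodularity, to covers of all edges of too small total size.\<close>

lemma critical_inj_on_fst:
  assumes large: "\<And>P Q. edge_cover E P Q \<Longrightarrow> m \<le> card P + card Q"
    and critical: "\<And>e. e \<in> E \<Longrightarrow> \<exists>P Q. edge_cover (E - {e}) P Q \<and> card P + card Q < m"
  shows "inj_on fst E"
proof (rule inj_onI, rule ccontr)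
  fix e f
  assume "e \<in> E" "f \<in> E" "fst e = fst f" "e \<noteq> f"
  then obtain x y z where xyz: "(x, y) \<in> E" "(x, z) \<in> E" "y \<noteq> z"
    by (metis prod.collapse)
  obtain P1 Q1 where 1: "edge_cover (E - {(x, y)}) P1 Q1" "card P1 + card Q1 < m"
    using critical xyz(1) by blast
  obtain P2 Q2 where 2: "edge_cover (E - {(x, z)}) P2 Q2" "card P2 + card Q2 < m"
    using critical xyz(2) by blast
  have fin: "finite P1" "finite Q1" "finite P2" "finite Q2"
    using 1(1) 2(1) by (auto simp: edge_cover_def)
  have "x \<notin> P1"
  proof
    assume "x \<in> P1"
    with 1(1) have "edge_cover E P1 Q1"
      by (auto simp: edge_cover_def)
    with large 1(2) show False by fastforce
  qed
  moreover have "x \<notin> P2"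
  proof
    assume "x \<in> P2"
    with 2(1) have "edge_cover E P2 Q2"
      by (auto simp: edge_cover_def)
    with large 2(2) show False by fastforce
  qed
  ultimately have "z \<in> Q1" "y \<in> Q2"
    using 1(1) 2(1) xyz by (auto simp: edge_cover_def)
  with 1(1) 2(1) have "edge_cover E (P1 \<inter> P2) (Q1 \<union> Q2)"
    by (auto simp: edge_cover_def)
  then have "m \<le> card (P1 \<inter> P2) + card (Q1 \<union> Q2)"
    by (rule large)
  moreover have "edge_cover E (insert x (P1 \<union> P2)) (Q1 \<inter> Q2)"
    using 1(1) 2(1) by (auto simp: edge_cover_def)
  then have "m \<le> card (insert x (P1 \<union> P2)) + card (Q1 \<inter> Q2)"
    by (rule large)
  moreover have "card (insert x (P1 \<union> P2)) \<le> Suc (card (P1 \<union> P2))"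
    by (simp add: card_insert_le_m1 card_insert_if fin)
  moreover have "card P1 + card P2 = card (P1 \<union> P2) + card (P1 \<inter> P2)"
    "card Q1 + card Q2 = card (Q1 \<union> Q2) + card (Q1 \<inter> Q2)"
    using fin card_Un_Int by blast+
  \<comment> \<open>Together, \<open>2 * m\<close> is at most the total size of the two given covers
    plus 1, while each of them has at most \<open>m - 1\<close> elements.\<close>
  ultimately show False
    using 1(2) 2(2) by linarith
qed

lemma edge_cover_converse: "edge_cover (E\<inverse>) P Q \<longleftrightarrow> edge_cover E Q P"
  by (auto simp: edge_cover_def)

text \<open>Delete edges while all covers keep size at least \<open>m\<close>. When this stops,
  \<open>critical_inj_on_fst\<close> for the graph and its converse shows that the edges form a
  matching; their first endpoints are a cover, so at least \<open>m\<close> edges remain.\<close>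

theorem koenig:
  assumes "finite E" and "\<And>P Q. edge_cover E P Q \<Longrightarrow> m \<le> card P + card Q"
  obtains M where "M \<subseteq> E" "inj_on fst M" "inj_on snd M" "card M = m"
  using assms
proof (induction "card E" arbitrary: E thesis rule: less_induct)
  case less
  show ?case
  proof (cases "\<exists>e\<in>E. \<forall>P Q. edge_cover (E - {e}) P Q \<longrightarrow> m \<le> card P + card Q")
    case True
    then obtain e where "e \<in> E" and e: "\<And>P Q. edge_cover (E - {e}) P Q \<Longrightarrow> m \<le> card P + card Q"
      by blast
    have "card (E - {e}) < card E"
      using \<open>e \<in> E\<close> less.prems(2) by (rule card_Diff1_less[rotated])
    then obtain M where "M \<subseteq> E - {e}" "inj_on fst M" "inj_on snd M" "card M = m"
      using less.hyps e less.prems(2) by (metis finite_Diff)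
    then show thesis
      using less.prems(1) by blast
  next
    case False
    then have critical: "\<exists>P Q. edge_cover (E - {e}) P Q \<and> card P + card Q < m" if "e \<in> E" for e
      using that by (meson not_le)
    have fst: "inj_on fst E"
      using less.prems(3) critical by (rule critical_inj_on_fst)
    have "inj_on fst (E\<inverse>)"
    proof (rule critical_inj_on_fst)
      show "m \<le> card P + card Q" if "edge_cover (E\<inverse>) P Q" for P Q
        using less.prems(3) that by (metis add.commute edge_cover_converse)
      show "\<exists>P Q. edge_cover (E\<inverse> - {e}) P Q \<and> card P + card Q < m" if "e \<in> E\<inverse>" for e
      proof -
        have "E\<inverse> - {e} = (E - {prod.swap e})\<inverse>"
          by (cases e) auto
        moreover have "prod.swap e \<in> E"
          using that by auto
        then obtain P Q where "edge_cover (E - {prod.swap e}) P Q" "card P + card Q < m"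
          using critical by blast
        ultimately show ?thesis
          by (metis add.commute edge_cover_converse)
      qed
    qed
    then have "inj_on (fst \<circ> prod.swap) E"
      by (intro comp_inj_on inj_on_subset[OF inj_swap]) (auto simp: converse_unfold image_def elim: inj_on_subset)
    then have snd: "inj_on snd E"
      by (simp add: comp_def)
    have "edge_cover E (fst ` E) {}"
      using less.prems(2) by (force simp: edge_cover_def)
    then have "m \<le> card E"
      using less.prems(3) fst by (fastforce simp: card_image)
    then obtain M where "M \<subseteq> E" "card M = m"
      using obtain_subset_with_card_n by metis
    with fst snd show thesis
      by (intro less.prems(1)[of M]) (auto intro: inj_on_subset)
  qed
qed

text \<open>Reduction to \<open>koenig\<close>: each vertex \<open>x\<close> is replaced by
  \<open>v x\<close> copies and each edge by all pairs of copies of its ends.\<close>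

theorem koenig_weighted:
  fixes v :: "'v \<Rightarrow> nat"
  assumes "finite A" "finite B" "A \<inter> B = {}" "E \<subseteq> A \<times> B"
    and large: "\<And>X. X \<subseteq> A \<union> B \<Longrightarrow> (\<And>x y. (x, y) \<in> E \<Longrightarrow> x \<in> X \<or> y \<in> X) \<Longrightarrow> m \<le> sum v X"
  obtains Ss where "length Ss = m" "\<And>S. S \<in> set Ss \<Longrightarrow> \<exists>(x, y)\<in>E. S = {x, y}"
    "\<And>i. (\<Sum>S\<leftarrow>Ss. of_bool (i \<in> S)) \<le> v i"
proof -
  define c where "c = (\<lambda>x. {x} \<times> {..<v x})"
  define E' where "E' = (\<Union>(x, y)\<in>E. c x \<times> c y)"
  have finE: "finite E"
    using assms(1,2,4) by (meson finite_SigmaI finite_subset)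
  then have "finite E'"
    by (auto simp: E'_def c_def)
  moreover have "m \<le> card P + card Q" if cov: "edge_cover E' P Q" for P Q
  proof -
    \<comment> \<open>The vertices all of whose copies are covered. An edge with an uncovered copy
      at both ends would give an uncovered edge of \<open>E'\<close>. Vertices of weight 0 belong to
      \<open>X\<close> at no cost.\<close>
    define X where "X = {x \<in> A. c x \<subseteq> P} \<union> {y \<in> B. c y \<subseteq> Q}"
    have fin: "finite P" "finite Q"
      using cov by (auto simp: edge_cover_def)
    have "x \<in> X \<or> y \<in> X" if "(x, y) \<in> E" for x y
    proof (rule ccontr)
      assume "\<not> ?thesis"
      moreover have "x \<in> A" "y \<in> B"
        using that assms(4) by auto
      ultimately obtain s t where "s \<in> c x" "s \<notin> P" "t \<in> c y" "t \<notin> Q"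
        by (auto simp: X_def)
      moreover have "(s, t) \<in> E'"
        using that \<open>s \<in> c x\<close> \<open>t \<in> c y\<close> by (auto simp: E'_def)
      ultimately show False
        using cov by (auto simp: edge_cover_def)
    qed
    then have "m \<le> sum v X"
      by (intro large) (auto simp: X_def)
    also have "\<dots> = sum v {x \<in> A. c x \<subseteq> P} + sum v {y \<in> B. c y \<subseteq> Q}"
      unfolding X_def using assms(1-3) by (intro sum.union_disjoint) auto
    also have "sum v {x \<in> A. c x \<subseteq> P} = card (SIGMA x:{x \<in> A. c x \<subseteq> P}. {..<v x})"
      using assms(1) by simp
    also have "\<dots> \<le> card P"
      using fin(1) by (intro card_mono) (auto simp: c_def)
    also have "sum v {x \<in> B. c x \<subseteq> Q} = card (SIGMA x:{x \<in> B. c x \<subseteq> Q}. {..<v x})"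
      using assms(2) by simp
    also have "\<dots> \<le> card Q"
      using fin(2) by (intro card_mono) (auto simp: c_def)
    finally show ?thesis by simp
  qed
  ultimately obtain M where M: "M \<subseteq> E'" "inj_on fst M" "inj_on snd M" "card M = m"
    using koenig by metis
  then have finM: "finite M"
    using \<open>finite E'\<close> finite_subset by blast
  \<comment> \<open>A list keeps multiplicities: distinct edges between copies may project to the
    same pair.\<close>
  then obtain xs where xs: "set xs = M" "distinct xs"
    using finite_distinct_list by blast
  have deg_fst: "card {e \<in> M. fst (fst e) = i} \<le> v i" for i
  proof -
    have "card {e \<in> M. fst (fst e) = i} = card (fst ` {e \<in> M. fst (fst e) = i})"
      using M(2) by (intro card_image[symmetric] inj_on_subset[OF M(2)]) auto
    also have "\<dots> \<le> card (c i)"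
      using M(1) by (intro card_mono) (auto simp: c_def E'_def)
    finally show ?thesis by (simp add: c_def)
  qed
  have deg_snd: "card {e \<in> M. fst (snd e) = i} \<le> v i" for i
  proof -
    have "card {e \<in> M. fst (snd e) = i} = card (snd ` {e \<in> M. fst (snd e) = i})"
      using M(3) by (intro card_image[symmetric] inj_on_subset[OF M(3)]) auto
    also have "\<dots> \<le> card (c i)"
      using M(1) by (intro card_mono) (auto simp: c_def E'_def)
    finally show ?thesis by (simp add: c_def)
  qed
  let ?g = "\<lambda>e. {fst (fst e), fst (snd e)}"
  have ME: "(fst (fst e), fst (snd e)) \<in> E" if "e \<in> M" for e
    using that M(1) by (auto simp: E'_def c_def)
  show thesis
  proof (rule that[of "map ?g xs"])
    show "length (map ?g xs) = m"
      using xs M(4) distinct_card by fastforce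
    show "\<exists>(x, y)\<in>E. S = {x, y}" if "S \<in> set (map ?g xs)" for S
      using that ME xs(1) by auto
    show "(\<Sum>S\<leftarrow>map ?g xs. of_bool (i \<in> S)) \<le> v i" for i
    proof -
      have "(\<Sum>S\<leftarrow>map ?g xs. of_bool (i \<in> S)) = (\<Sum>e\<in>M. of_bool (i \<in> ?g e) :: nat)"
        using xs by (simp add: comp_def sum_list_distinct_conv_sum_set)
      also have "\<dots> = card {e \<in> M. i \<in> ?g e}"
        using finM by (subst sum_of_bool_eq) (simp_all add: Int_def)
      also have "\<dots> \<le> v i"
      proof (cases "i \<in> A")
        case True
        then have "{e \<in> M. i \<in> ?g e} = {e \<in> M. fst (fst e) = i}"
          using ME assms(3,4) by blast
        then show ?thesis using deg_fst by simp
      next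
        case False
        then have "{e \<in> M. i \<in> ?g e} = {e \<in> M. fst (snd e) = i}"
          using ME assms(3,4) by blast
        then show ?thesis using deg_snd by simp
      qed
      finally show ?thesis .
    qed
  qed
qed

section \<open>Pure two-dimensional complexes on six vertices\<close>

lemma card_facet:
  assumes "simplicial_complex \<Delta>" "pure \<Delta>" "complex_dim \<Delta> = 2" "F \<in> facets \<Delta>"
  shows "card F = 3"
proof -
  have "\<Delta> \<noteq> {}"
    using assms(1) by (auto simp: simplicial_complex_def)
  then have "complex_dim \<Delta> \<in> face_dim ` \<Delta>"
    unfolding complex_dim_def by (intro Max_in) auto
  then obtain G where G: "G \<in> \<Delta>" "card G = 3"
    using assms(3) by (auto simp: face_dim_def)
  have "card H \<le> 3" if "H \<in> \<Delta>" for H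
  proof -
    have "face_dim H \<le> complex_dim \<Delta>"
      unfolding complex_dim_def using that by (intro Max_ge) auto
    then show ?thesis using assms(3) by (simp add: face_dim_def)
  qed
  then have "H = G" if "H \<in> \<Delta>" "G \<subseteq> H" for H
    using that G(2) card_seteq[of H G] by auto
  with G(1) have "G \<in> facets \<Delta>"
    by (auto simp: facets_def)
  then have "face_dim F = face_dim G"
    using assms(2,4) unfolding pure_def by blast
  then show ?thesis
    using G(2) by (simp add: face_dim_def)
qed

locale complex6 =
  fixes \<Delta> :: "'v::finite set set"
  assumes card_vertices: "CARD('v) = 6"
    and complex: "simplicial_complex \<Delta>"
    and card_facet: "\<And>F. F \<in> facets \<Delta> \<Longrightarrow> card F = 3"
begin

lemma subface: "F \<in> \<Delta> \<Longrightarrow> G \<subseteq> F \<Longrightarrow> G \<in> \<Delta>"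
  using complex unfolding simplicial_complex_def by blast

lemma vertex_face: "{i} \<in> \<Delta>"
  using complex unfolding simplicial_complex_def by blast

lemma face_subset_facet:
  assumes "G \<in> \<Delta>"
  obtains F where "F \<in> facets \<Delta>" "G \<subseteq> F"
proof -
  obtain F where "F \<in> \<Delta>" "G \<subseteq> F" "\<forall>H\<in>\<Delta>. F \<subseteq> H \<longrightarrow> F = H"
    using finite_has_maximal2[of \<Delta> G] assms by auto
  then show thesis
    by (intro that[of F]) (auto simp: facets_def)
qed

lemma facet_face: "F \<in> facets \<Delta> \<Longrightarrow> F \<in> \<Delta>"
  by (simp add: facets_def)

lemma facet_iff: "F \<in> facets \<Delta> \<longleftrightarrow> F \<in> \<Delta> \<and> card F = 3"
proof
  assume F: "F \<in> \<Delta> \<and> card F = 3"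
  then obtain G where "G \<in> facets \<Delta>" "F \<subseteq> G"
    using face_subset_facet by blast
  moreover from this have "F = G"
    using F card_facet by (intro card_subset_eq) auto
  ultimately show "F \<in> facets \<Delta>" by simp
qed (simp add: facet_face card_facet)

lemma card_Compl_facet: "F \<in> facets \<Delta> \<Longrightarrow> card (-F) = 3"
  using card_facet card_vertices by (simp add: Compl_eq_Diff_UNIV card_Diff_subset)

text \<open>The empty set and the singletons are faces. Hence \<open>m\<close> nonfaces have total
  size at least \<open>2 * m\<close>.\<close>

lemma small_nonface:
  assumes "S \<notin> \<Delta>"
  shows "2 \<le> card S"
proof (rule ccontr)
  assume "\<not> 2 \<le> card S"
  then have "card S = 0 \<or> card S = Suc 0" by linarith
  then obtain i where "S \<subseteq> {i}"
    by (auto simp: card_Suc_eq)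
  then show False
    using assms subface vertex_face by blast
qed

lemma nonedge_iff: "e \<in> complement_graph (graph_of \<Delta>) \<longleftrightarrow> card e = 2 \<and> e \<notin> \<Delta>"
  by (auto simp: complement_graph_def graph_of_def)

lemma triangle_iff:
  "T \<in> triangles (graph_of \<Delta>) \<longleftrightarrow> card T = 3 \<and> (\<forall>u\<in>T. \<forall>w\<in>T. {u, w} \<in> \<Delta>)"
proof -
  have "{u, w} \<in> \<Delta> \<longleftrightarrow> u = w \<or> {u, w} \<in> graph_of \<Delta>" for u w
    using vertex_face by (auto simp: graph_of_def card_2_iff)
  then show ?thesis
    unfolding triangles_def by blast
qed

lemma facet_triangle: "F \<in> facets \<Delta> \<Longrightarrow> F \<in> triangles (graph_of \<Delta>)"
  unfolding triangle_iff by (auto simp: card_facet intro: subface facet_face)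

section \<open>Perfect matchings of nonedges and their transversals\<close>

text \<open>A perfect matching of the complement graph with named ends, so that each pair can be
  oriented. Distinctness comes for free, as six names cover six vertices.\<close>

definition matching :: "'v \<Rightarrow> 'v \<Rightarrow> 'v \<Rightarrow> 'v \<Rightarrow> 'v \<Rightarrow> 'v \<Rightarrow> bool" where
  "matching a1 b1 a2 b2 a3 b3 \<longleftrightarrow> UNIV = {a1, b1, a2, b2, a3, b3} \<and> {a1, b1} \<notin> \<Delta> \<and> {a2, b2} \<notin> \<Delta> \<and> {a3, b3} \<notin> \<Delta>"

lemma matching_distinct:
  assumes "matching a1 b1 a2 b2 a3 b3"
  shows "distinct [a1, b1, a2, b2, a3, b3]"
proof (rule card_distinct)
  have "set [a1, b1, a2, b2, a3, b3] = UNIV"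
    using assms by (simp add: matching_def)
  then show "card (set [a1, b1, a2, b2, a3, b3]) = length [a1, b1, a2, b2, a3, b3]"
    using card_vertices by simp
qed

text \<open>A triangle contains no nonedge, so it has at most one end of each of the three pairs
  and, having three vertices, exactly one. Swapping ends within the pairs puts the triangle
  first.\<close>

lemma matching_transversal:
  assumes "matching a1 b1 a2 b2 a3 b3" "T \<in> triangles (graph_of \<Delta>)"
  obtains x1 y1 x2 y2 x3 y3 where "matching x1 y1 x2 y2 x3 y3"
    "{x1, y1} = {a1, b1}" "{x2, y2} = {a2, b2}" "{x3, y3} = {a3, b3}"
    "T = {x1, x2, x3}" "-T = {y1, y2, y3}"
proof -
  define x where "x a b = (if a \<in> T then a else b)" for a b
  define y where "y a b = (if a \<in> T then b else a)" for a b
  have xy: "{x a b, y a b} = {a, b}" for a b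
    by (auto simp: x_def y_def)
  have T: "card T = 3" "\<And>u w. u \<in> T \<Longrightarrow> w \<in> T \<Longrightarrow> {u, w} \<in> \<Delta>"
    using assms(2) by (auto simp: triangle_iff)
  have M: "UNIV = {a1, b1, a2, b2, a3, b3}" "{a1, b1} \<notin> \<Delta>" "{a2, b2} \<notin> \<Delta>" "{a3, b3} \<notin> \<Delta>"
    using assms(1) by (simp_all add: matching_def)
  have "t \<in> {x a1 b1, x a2 b2, x a3 b3}" if "t \<in> T" for t
  proof -
    have "t \<in> {a1, b1, a2, b2, a3, b3}" using M(1) by blast
    then show ?thesis
      using that T(2) M(2-4) by (auto simp: x_def)
  qed
  then have "T \<subseteq> {x a1 b1, x a2 b2, x a3 b3}" by blast
  moreover have "card {x a1 b1, x a2 b2, x a3 b3} \<le> card T"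
    unfolding T(1) by (simp add: card_insert_if)
  ultimately have Tx: "T = {x a1 b1, x a2 b2, x a3 b3}"
    by (intro card_seteq) auto
  have m: "matching (x a1 b1) (y a1 b1) (x a2 b2) (y a2 b2) (x a3 b3) (y a3 b3)"
    unfolding matching_def xy using M by (auto simp: x_def y_def)
  have "-T = {y a1 b1, y a2 b2, y a3 b3}"
    using matching_distinct[OF m] m unfolding Tx by (auto simp: matching_def)
  with m Tx xy show thesis
    by (intro that)
qed

section \<open>Sufficiency: packings from two disjoint triangles\<close>

text \<open>Every edge \<open>{xi, xj}\<close> lies in a facet, which must be \<open>{xi, xj, yk}\<close>. Hence \<open>v xk\<close> exceeds \<open>v yk\<close>
  by at least the deficit \<open>m - (v y1 + v y2 + v y3)\<close>, which the nonface \<open>{x1, x2, x3}\<close> makes up.\<close>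

lemma packs_of_nonface_triangle:
  assumes "matching x1 y1 x2 y2 x3 y3"
    and tri: "{x1, x2, x3} \<in> triangles (graph_of \<Delta>)" and nonface: "{x1, x2, x3} \<notin> \<Delta>"
    and v: "\<And>F. F \<in> facets \<Delta> \<Longrightarrow> m \<le> sum v (-F)"
    and less: "v y1 + v y2 + v y3 \<le> m"
  shows "packs \<Delta> m v"
proof -
  define t where "t = m - (v y1 + v y2 + v y3)"
  \<comment> \<open>Stated for arbitrary names, so that the three bounds in \<open>le\<close> are
    instances of one argument; \<open>c\<close> is the partner of \<open>z\<close>.\<close>
  have key: "v c + t \<le> v z"
    if M: "matching a a' b b' z c" and "{a, b, z} = {x1, x2, x3}" "{a', b', c} = {y1, y2, y3}" for a a' b b' z c
  proof -
    have "a \<in> {x1, x2, x3}" "b \<in> {x1, x2, x3}"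
      using that(2) by blast+
    then have "{a, b} \<in> \<Delta>"
      using tri unfolding triangle_iff by blast
    then obtain F where F: "F \<in> facets \<Delta>" "{a, b} \<subseteq> F"
      using face_subset_facet by blast
    have d: "distinct [a, a', b, b', z, c]"
      using M by (rule matching_distinct)
    have U: "UNIV = {a, a', b, b', z, c}"
      using M by (simp add: matching_def)
    have "\<not> {a, a'} \<subseteq> F" "\<not> {b, b'} \<subseteq> F" "\<not> {a, b, z} \<subseteq> F"
      using M nonface subface[OF facet_face[OF F(1)]] unfolding that(2) matching_def by blast+
    with F(2) have "a' \<notin> F" "b' \<notin> F" "z \<notin> F"
      by blast+
    then have "{a', b', z} \<subseteq> -F" by blast
    moreover have "card {a', b', z} = card (-F)"
      using d card_Compl_facet[OF F(1)] by simp
    ultimately have "-F = {a', b', z}"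
      by (metis card_subset_eq finite)
    then have "m \<le> v a' + v b' + v z"
      using v[OF F(1)] d by simp
    moreover have "v a' + v b' + v c = v y1 + v y2 + v y3"
    proof -
      have "v a' + v b' + v c = sum v {a', b', c}" using d by simp
      also have "\<dots> = sum v {y1, y2, y3}" using that(3) by simp
      also have "\<dots> = v y1 + v y2 + v y3" using matching_distinct[OF assms(1)] by simp
      finally show ?thesis .
    qed
    ultimately show ?thesis
      using less by (simp add: t_def)
  qed
  have le: "v y1 + t \<le> v x1" "v y2 + t \<le> v x2" "v y3 + t \<le> v x3"
    using assms(1)
    by (auto intro!: key[of x3 y3 x2 y2 x1 y1] key[of x1 y1 x3 y3 x2 y2] key[of x1 y1 x2 y2 x3 y3]
        simp: matching_def)
  let ?Ss = "replicate t {x1, x2, x3} @ replicate (v y1) {x1, y1} @ replicate (v y2) {x2, y2} @ replicate (v y3) {x3, y3}"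
  have "(\<Sum>S\<leftarrow>?Ss. of_bool (i \<in> S)) \<le> v i" for i
  proof -
    have "i \<in> {x1, y1, x2, y2, x3, y3}"
      using assms(1) by (auto simp: matching_def)
    then show ?thesis
      using le matching_distinct[OF assms(1)] by (auto simp: sum_list_replicate)
  qed
  moreover have "length ?Ss = m"
    using less by (simp add: t_def)
  moreover have "set ?Ss \<inter> \<Delta> = {}"
    using assms(1) nonface by (auto simp: matching_def)
  ultimately show ?thesis
    unfolding packs_def by blast
qed

text \<open>A vertex cover of the nonedges between the two triangles is the complement of a clique of the
  1-skeleton, so the assumed bounds are exactly the hypothesis of Koenig's theorem.\<close>

lemma packs_of_triangle_bounds:
  assumes M: "matching a1 b1 a2 b2 a3 b3"
    and T: "{a1, a2, a3} \<in> triangles (graph_of \<Delta>)" "{b1, b2, b3} \<in> triangles (graph_of \<Delta>)"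
    and v: "\<And>T. T \<in> triangles (graph_of \<Delta>) \<Longrightarrow> m \<le> sum v (-T)"
  shows "packs \<Delta> m v"
proof -
  let ?A = "{a1, a2, a3}" and ?B = "{b1, b2, b3}"
  define E where "E = {(x, y). x \<in> ?A \<and> y \<in> ?B \<and> {x, y} \<notin> \<Delta>}"
  have "?A \<inter> ?B = {}"
    using matching_distinct[OF M] by auto
  have U: "UNIV = ?A \<union> ?B"
    using M by (auto simp: matching_def)
  have large: "m \<le> sum v X" if "X \<subseteq> ?A \<union> ?B" and X: "\<And>x y. (x, y) \<in> E \<Longrightarrow> x \<in> X \<or> y \<in> X" for X
  proof -
    have clique: "{u, w} \<in> \<Delta>" if "u \<in> -X" "w \<in> -X" for u w
    proof -
      have "u \<in> ?A \<or> u \<in> ?B" "w \<in> ?A \<or> w \<in> ?B"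
        using U by blast+
      then show ?thesis
        using that X[of u w] X[of w u] T unfolding E_def triangle_iff
        by (auto simp: insert_commute)
    qed
    \<comment> \<open>A clique that is a face extends to a facet. Otherwise it has more than two
      vertices, and at most three because it takes at most one end of each matched pair.\<close>
    have "\<exists>T\<in>triangles (graph_of \<Delta>). -X \<subseteq> T"
    proof (cases "-X \<in> \<Delta>")
      case True
      then show ?thesis
        using face_subset_facet facet_triangle by metis
    next
      case False
      then have two: "2 \<le> card (-X)" by (rule small_nonface)
      have "card (-X) \<noteq> 2"
      proof
        assume "card (-X) = 2"
        then obtain u w where "-X = {u, w}" by (auto simp: card_2_iff)
        with clique False show False by (metis insertCI)
      qed
      moreover have "card (-X) \<le> 3"
      proof -
        let ?c = "\<lambda>a b. if a \<in> -X then a else b"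
        have "u \<in> {?c a1 b1, ?c a2 b2, ?c a3 b3}" if "u \<in> -X" for u
        proof -
          have "u \<in> {a1, b1, a2, b2, a3, b3}" using M by (auto simp: matching_def)
          then show ?thesis
            using that clique M by (auto simp: matching_def)
        qed
        then have "-X \<subseteq> {?c a1 b1, ?c a2 b2, ?c a3 b3}" by blast
        then have "card (-X) \<le> card {?c a1 b1, ?c a2 b2, ?c a3 b3}"
          by (intro card_mono) simp
        also have "\<dots> \<le> 3" by (simp add: card_insert_if)
        finally show ?thesis .
      qed
      ultimately have "-X \<in> triangles (graph_of \<Delta>)"
        using two clique by (simp add: triangle_iff)
      then show ?thesis by blast
    qed
    then obtain T where "T \<in> triangles (graph_of \<Delta>)" "-T \<subseteq> X" by blast
    then show ?thesis
      using v sum_mono2[of X "-T" v] by (meson finite le_trans zero_le)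
  qed
  have "E \<subseteq> ?A \<times> ?B"
    by (auto simp: E_def)
  from koenig_weighted[OF _ _ \<open>?A \<inter> ?B = {}\<close> this large]
  obtain Ss where Ss: "length Ss = m" "\<And>S. S \<in> set Ss \<Longrightarrow> \<exists>(x, y)\<in>E. S = {x, y}"
    "\<And>i. (\<Sum>S\<leftarrow>Ss. of_bool (i \<in> S)) \<le> v i"
    by (metis finite.emptyI finite.insertI)
  have "S \<notin> \<Delta>" if "S \<in> set Ss" for S
    using Ss(2)[OF that] unfolding E_def by blast
  with Ss show ?thesis
    unfolding packs_def by blast
qed

lemma packs_of_disjoint_triangles:
  assumes M: "matching a1 b1 a2 b2 a3 b3"
    and T: "{a1, a2, a3} \<in> triangles (graph_of \<Delta>)" "{b1, b2, b3} \<in> triangles (graph_of \<Delta>)"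
    and v: "\<And>F. F \<in> facets \<Delta> \<Longrightarrow> m \<le> sum v (-F)"
  shows "packs \<Delta> m v"
proof (cases "\<forall>T\<in>triangles (graph_of \<Delta>). m \<le> sum v (-T)")
  case True
  then show ?thesis
    by (intro packs_of_triangle_bounds[OF M T]) blast
next
  case False
  then obtain T where T: "T \<in> triangles (graph_of \<Delta>)" "sum v (-T) < m" by force
  then have "T \<notin> \<Delta>"
    using v[of T] by (auto simp: facet_iff triangle_iff)
  obtain x1 y1 x2 y2 x3 y3 where x: "matching x1 y1 x2 y2 x3 y3" "T = {x1, x2, x3}" "-T = {y1, y2, y3}"
    using matching_transversal[OF M T(1)] by metis
  then have "v y1 + v y2 + v y3 \<le> m"
    using T(2) matching_distinct[OF x(1)] by simp
  with x T(1) \<open>T \<notin> \<Delta>\<close> v show ?thesis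
    by (intro packs_of_nonface_triangle) auto
qed

section \<open>Necessity: special exponents force a matching and two triangles\<close>

text \<open>In terms of exponents, the inclusion of the symbolic in the ordinary power;
  \<open>packs_imp_symbolic\<close> is the converse.\<close>

definition symbolic_packs :: "nat \<Rightarrow> bool" where
  "symbolic_packs m \<longleftrightarrow> (\<forall>v. (\<forall>F\<in>facets \<Delta>. m \<le> sum v (-F)) \<longrightarrow> packs \<Delta> m v)"

lemma sum_of_bool_mem:
  fixes X S :: "'v set"
  shows "(\<Sum>i\<in>X. of_bool (i \<in> S)) = (card (X \<inter> S) :: nat)"
  by (subst sum_of_bool_eq) simp_all

lemma sum_exponent:
  fixes X S :: "'v set" and k r :: nat
  shows "(\<Sum>i\<in>X. k + r * of_bool (i \<in> S)) = k * card X + r * card (X \<inter> S)"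
  by (simp only: sum.distrib sum_constant sum_of_bool_mem mult.commute of_nat_id flip: sum_distrib_left)

text \<open>The complement of a facet has three vertices and meets the nonface \<open>S\<close>, so
  the exponent sums over it to at least \<open>3 * (m div 3) + m mod 3\<close>.\<close>

lemma obtain_nonfaces:
  assumes "symbolic_packs m" "S \<notin> \<Delta>"
  obtains Ss where "length Ss = m" "\<And>T. T \<in> set Ss \<Longrightarrow> T \<notin> \<Delta>"
    "\<And>i. (\<Sum>T\<leftarrow>Ss. of_bool (i \<in> T)) \<le> m div 3 + m mod 3 * of_bool (i \<in> S)"
proof -
  have "m \<le> (\<Sum>i\<in>-F. m div 3 + m mod 3 * of_bool (i \<in> S))" if F: "F \<in> facets \<Delta>" for F
  proof -
    have "-F \<inter> S \<noteq> {}"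
      using assms(2) subface[OF facet_face[OF F]] by blast
    then have "1 \<le> card (-F \<inter> S)"
      by (simp add: Suc_le_eq card_gt_0_iff)
    then have "m mod 3 * 1 \<le> m mod 3 * card (-F \<inter> S)"
      by (rule mult_left_mono) simp
    then show ?thesis
      unfolding sum_exponent card_Compl_facet[OF F] by presburger
  qed
  then have "packs \<Delta> m (\<lambda>i. m div 3 + m mod 3 * of_bool (i \<in> S))"
    using assms(1) unfolding symbolic_packs_def by blast
  then show thesis
    unfolding packs_def using that by blast
qed

lemma sum_list_card:
  fixes Ss :: "'v set list"
  shows "(\<Sum>T\<leftarrow>Ss. card (X \<inter> T)) = (\<Sum>i\<in>X. \<Sum>T\<leftarrow>Ss. of_bool (i \<in> T))"
  by (induction Ss) (simp_all only: list.map sum_list.Nil sum_list.Cons sum.distrib sum_of_bool_mem sum.neutral_const)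

text \<open>A nonface of minimal size \<open>s\<close> gives an exponent of degree \<open>6k + rs\<close>, where \<open>m = 3k + r\<close>,
  and \<open>m\<close> nonfaces have total size at least \<open>ms\<close>.\<close>

lemma exists_nonedge:
  assumes "symbolic_packs m" "3 \<le> m"
  obtains e where "e \<notin> \<Delta>" "card e = 2"
proof -
  have "UNIV \<notin> \<Delta>"
  proof
    assume "UNIV \<in> \<Delta>"
    then obtain G where "G \<in> facets \<Delta>" "UNIV \<subseteq> G"
      using face_subset_facet by metis
    then show False
      using card_facet[of G] card_vertices by (simp add: top.extremum_unique)
  qed
  then obtain S where S: "S \<notin> \<Delta>" "\<And>T. T \<notin> \<Delta> \<Longrightarrow> card S \<le> card T"
    using ex_has_least_nat[of "\<lambda>S. S \<notin> \<Delta>" UNIV card] by metis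
  obtain Ss where Ss: "length Ss = m" "\<And>T. T \<in> set Ss \<Longrightarrow> T \<notin> \<Delta>"
    "\<And>i. (\<Sum>T\<leftarrow>Ss. of_bool (i \<in> T)) \<le> m div 3 + m mod 3 * of_bool (i \<in> S)"
    using obtain_nonfaces[OF assms(1) S(1)] by metis
  have "m * card S = (\<Sum>T\<leftarrow>Ss. card S)"
    using Ss(1) by (simp add: sum_list_triv)
  also have "\<dots> \<le> (\<Sum>T\<leftarrow>Ss. card (UNIV \<inter> T))"
    using S(2) Ss(2) by (intro sum_list_mono) simp
  also have "\<dots> \<le> (\<Sum>i\<in>UNIV. m div 3 + m mod 3 * of_bool (i \<in> S))"
    unfolding sum_list_card by (intro sum_mono Ss(3))
  also have "\<dots> = 6 * (m div 3) + m mod 3 * card S"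
    unfolding sum_exponent card_vertices by simp
  finally have "m * card S \<le> 6 * (m div 3) + m mod 3 * card S" .
  moreover have "m * card S = 3 * (m div 3) * card S + m mod 3 * card S"
    by (metis distrib_right mult_div_mod_eq)
  ultimately have "(m div 3) * (3 * card S) \<le> (m div 3) * 6"
    by (simp add: mult_ac)
  then have "card S \<le> 2"
    using assms(2) by (simp add: div_greater_zero_iff)
  with S(1) small_nonface have "card S = 2" by (simp add: le_antisym)
  with S(1) that show thesis by blast
qed

text \<open>The exponent has degree exactly \<open>2 * m\<close>, the least possible for
  \<open>m\<close> nonfaces, so both estimates are tight: no nonface has more than two vertices and
  no unit of the exponent is left over.\<close>

lemma obtain_edges:
  assumes "symbolic_packs m" "e \<notin> \<Delta>" "card e = 2"
  obtains Ss where "length Ss = m" "\<And>T. T \<in> set Ss \<Longrightarrow> T \<notin> \<Delta> \<and> card T = 2"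
    "\<And>i. (\<Sum>T\<leftarrow>Ss. of_bool (i \<in> T)) = m div 3 + m mod 3 * of_bool (i \<in> e)"
proof -
  obtain Ss where Ss: "length Ss = m" "\<And>T. T \<in> set Ss \<Longrightarrow> T \<notin> \<Delta>"
    "\<And>i. (\<Sum>T\<leftarrow>Ss. of_bool (i \<in> T)) \<le> m div 3 + m mod 3 * of_bool (i \<in> e)"
    using obtain_nonfaces[OF assms(1,2)] by metis
  let ?l = "\<lambda>i. \<Sum>T\<leftarrow>Ss. of_bool (i \<in> T) :: nat" and ?v = "\<lambda>i. m div 3 + m mod 3 * of_bool (i \<in> e)"
  have "(\<Sum>T\<leftarrow>Ss. card T) = (\<Sum>T\<leftarrow>Ss. 2 + (card T - 2))"
    by (intro arg_cong[of _ _ sum_list] map_cong refl) (metis Ss(2) small_nonface le_add_diff_inverse)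
  also have "\<dots> = 2 * m + (\<Sum>T\<leftarrow>Ss. card T - 2)"
    unfolding sum_list_addf using Ss(1) by (simp add: sum_list_triv)
  finally have low: "(\<Sum>T\<leftarrow>Ss. card T) = 2 * m + (\<Sum>T\<leftarrow>Ss. card T - 2)" .
  have total: "(\<Sum>i\<in>UNIV. ?v i) = 2 * m"
    unfolding sum_exponent card_vertices using assms(3) by simp presburger
  have "(\<Sum>i\<in>UNIV. ?v i) = (\<Sum>i\<in>UNIV. ?l i + (?v i - ?l i))"
    using Ss(3) by (intro sum.cong) simp_all
  also have "\<dots> = (\<Sum>T\<leftarrow>Ss. card T) + (\<Sum>i\<in>UNIV. ?v i - ?l i)"
    using sum_list_card[of UNIV Ss] by (simp add: sum.distrib)
  finally have "(\<Sum>T\<leftarrow>Ss. card T - 2) = 0" "(\<Sum>i\<in>UNIV. ?v i - ?l i) = 0"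
    using low total by linarith+
  then have "\<forall>T\<in>set Ss. card T - 2 = 0" "\<forall>i\<in>UNIV. ?v i - ?l i = 0"
    by (simp_all only: sum_list_eq_0_iff set_map sum_eq_0_iff finite) blast+
  with Ss small_nonface show thesis
    by (intro that[of Ss]) (simp_all add: le_antisym)
qed

text \<open>Every entry of the decomposed exponent is at least \<open>m div 3\<close>, hence
  positive, and is used up by nonedges.\<close>

lemma nonisolated:
  assumes "symbolic_packs m" "3 \<le> m"
  obtains j where "{i, j} \<notin> \<Delta>"
proof -
  obtain e where e: "e \<notin> \<Delta>" "card e = 2"
    using exists_nonedge assms by metis
  obtain Ss where Ss: "length Ss = m" "\<And>T. T \<in> set Ss \<Longrightarrow> T \<notin> \<Delta> \<and> card T = 2"
    "\<And>i. (\<Sum>T\<leftarrow>Ss. of_bool (i \<in> T)) = m div 3 + m mod 3 * of_bool (i \<in> e)"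
    using obtain_edges[OF assms(1) e] by metis
  have "0 < m div 3"
    using assms(2) by (simp add: div_greater_zero_iff)
  then have "(\<Sum>T\<leftarrow>Ss. of_bool (i \<in> T)) \<noteq> (0::nat)"
    unfolding Ss(3) by linarith
  then obtain T where T: "T \<in> set Ss" "i \<in> T"
    by (auto simp: sum_list_eq_0_iff)
  then obtain j where "T = {i, j}"
    using Ss(2)[OF T(1)] by (auto simp: card_2_iff)
  with T(1) Ss(2) that show thesis by blast
qed

text \<open>A violation of Hall's condition by \<open>I \<subseteq> F\<close> with neighbourhood \<open>Q\<close> in the graph of nonedges
  contradicts the decomposition of the exponent built from an edge between \<open>I\<close> and \<open>Q\<close>: the edges
  at \<open>I\<close> use up one unit of \<open>Q\<close> each.\<close>

lemma hall_condition:
  assumes "symbolic_packs m" "3 \<le> m" "F \<in> \<Delta>" "I \<subseteq> F" "Q \<inter> F = {}"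
    and nbrs: "\<And>x y. x \<in> I \<Longrightarrow> y \<notin> F \<Longrightarrow> {x, y} \<notin> \<Delta> \<Longrightarrow> y \<in> Q"
  shows "card I \<le> card Q"
proof (cases "I = {}")
  case False
  then obtain i where "i \<in> I" by blast
  obtain j where ij: "{i, j} \<notin> \<Delta>"
    using nonisolated assms(1,2) by metis
  have edge: "x \<in> I \<Longrightarrow> {x, y} \<notin> \<Delta> \<Longrightarrow> y \<in> Q" for x y
    using nbrs[of x y] subface[OF assms(3), of "{x, y}"] assms(4) by blast
  have "j \<in> Q" using edge \<open>i \<in> I\<close> ij by blast
  then have "i \<noteq> j" "j \<notin> I" "i \<notin> Q"
    using \<open>i \<in> I\<close> assms(4,5) by blast+
  \<comment> \<open>The edge \<open>{i, j}\<close> meets \<open>I\<close> and \<open>Q\<close> once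
    each, so the remainder terms will cancel in the comparison.\<close>
  then have card: "card {i, j} = 2" "card (I \<inter> {i, j}) = 1" "card (Q \<inter> {i, j}) = 1"
    using \<open>i \<in> I\<close> \<open>j \<in> Q\<close> by simp_all
  obtain Ss where Ss: "length Ss = m" "\<And>T. T \<in> set Ss \<Longrightarrow> T \<notin> \<Delta> \<and> card T = 2"
    "\<And>x. (\<Sum>T\<leftarrow>Ss. of_bool (x \<in> T)) = m div 3 + m mod 3 * of_bool (x \<in> {i, j})"
    using obtain_edges[OF assms(1) ij card(1)] by metis
  have "card (I \<inter> T) \<le> card (Q \<inter> T)" if "T \<in> set Ss" for T
  proof (cases "I \<inter> T = {}")
    case False
    then obtain x where x: "x \<in> I" "x \<in> T" by blast
    have T: "T \<notin> \<Delta>" "card T = 2"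
      using Ss(2)[OF that] by auto
    then obtain y where y: "T = {x, y}"
      using x(2) by (auto simp: card_2_iff)
    then have "y \<in> Q" using edge x T(1) by blast
    then have "I \<inter> T = {x}" "Q \<inter> T = {y}"
      using x y assms(4,5) by blast+
    then show ?thesis by simp
  qed simp
  then have "(\<Sum>T\<leftarrow>Ss. card (I \<inter> T)) \<le> (\<Sum>T\<leftarrow>Ss. card (Q \<inter> T))"
    by (rule sum_list_mono)
  then have "m div 3 * card I \<le> m div 3 * card Q"
    unfolding sum_list_card Ss(3) sum_exponent card by simp
  then show ?thesis
    using assms(2) by (simp add: div_greater_zero_iff)
qed simp

text \<open>Weighted Koenig with unit weights between \<open>F\<close> and its complement. If
  \<open>X\<close> is a cover, all nonedges leading from \<open>F - X\<close> out of
  \<open>F\<close> end in \<open>X - F\<close>, so \<open>hall_condition\<close> makes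
  \<open>X\<close> at least as large as \<open>F\<close>.\<close>

lemma exists_matching:
  assumes "symbolic_packs m" "3 \<le> m" and F: "F \<in> facets \<Delta>"
  obtains a1 b1 a2 b2 a3 b3 where "matching a1 b1 a2 b2 a3 b3" "F = {a1, a2, a3}"
proof -
  define E where "E = {(x, y). x \<in> F \<and> y \<notin> F \<and> {x, y} \<notin> \<Delta>}"
  have large: "3 \<le> (\<Sum>i\<in>X. 1::nat)" if "X \<subseteq> F \<union> -F" and X: "\<And>x y. (x, y) \<in> E \<Longrightarrow> x \<in> X \<or> y \<in> X" for X
  proof -
    have "card (F - X) \<le> card (X - F)"
      using X by (intro hall_condition[OF assms(1,2) facet_face[OF F]]) (auto simp: E_def)
    moreover have "card F = card (F - X) + card (X \<inter> F)" "card X = card (X - F) + card (X \<inter> F)"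
      by (simp_all add: card_Diff_subset_Int Int_commute card_mono)
    ultimately show ?thesis
      using card_facet[OF F] by simp
  qed
  have "F \<inter> -F = {}" "E \<subseteq> F \<times> -F" by (auto simp: E_def)
  from koenig_weighted[OF _ _ this large]
  obtain Ss where Ss: "length Ss = 3" "\<And>S. S \<in> set Ss \<Longrightarrow> \<exists>(x, y)\<in>E. S = {x, y}"
    "\<And>i. (\<Sum>S\<leftarrow>Ss. of_bool (i \<in> S)) \<le> (1::nat)"
    by (metis finite)
  obtain e1 e2 e3 where e: "Ss = [e1, e2, e3]"
    using Ss(1) by (auto simp: eval_nat_numeral length_Suc_conv)
  obtain a1 b1 where 1: "(a1, b1) \<in> E" "e1 = {a1, b1}"
    using Ss(2)[of e1] e by auto
  obtain a2 b2 where 2: "(a2, b2) \<in> E" "e2 = {a2, b2}"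
    using Ss(2)[of e2] e by auto
  obtain a3 b3 where 3: "(a3, b3) \<in> E" "e3 = {a3, b3}"
    using Ss(2)[of e3] e by auto
  have ne: "a1 \<noteq> a2" "a1 \<noteq> a3" "a2 \<noteq> a3" "b1 \<noteq> b2" "b1 \<noteq> b3" "b2 \<noteq> b3"
    using Ss(3)[of a1] Ss(3)[of a2] Ss(3)[of b1] Ss(3)[of b2] unfolding e 1 2 3 by (auto split: if_splits)
  have a: "{a1, a2, a3} = F"
    using 1 2 3 ne card_facet[OF F] by (intro card_seteq) (auto simp: E_def)
  have b: "{b1, b2, b3} = -F"
    using 1 2 3 ne card_Compl_facet[OF F] by (intro card_seteq) (auto simp: E_def)
  have "UNIV = {a1, a2, a3} \<union> {b1, b2, b3}"
    unfolding a b by simp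
  then have "matching a1 b1 a2 b2 a3 b3"
    using 1 2 3 unfolding matching_def E_def by auto
  with a that show thesis by blast
qed

text \<open>If all facets met the transversal \<open>y1, y2, y3\<close> in at most one vertex, then the exponent
  with weight \<open>m / 2\<close> on it (rounded suitably) would have degree less than \<open>2 m\<close>.\<close>

lemma no_centre:
  assumes "symbolic_packs m" "2 \<le> m" and M: "matching x1 y1 x2 y2 x3 y3"
  shows "{x1, y2, y3} \<in> \<Delta> \<or> {y1, x2, y3} \<in> \<Delta> \<or> {y1, y2, x3} \<in> \<Delta> \<or> {y1, y2, y3} \<in> \<Delta>"
proof (rule ccontr)
  assume "\<not> ?thesis"
  then have far: "{x1, y2, y3} \<notin> \<Delta>" "{y1, x2, y3} \<notin> \<Delta>" "{y1, y2, x3} \<notin> \<Delta>" "{y1, y2, y3} \<notin> \<Delta>"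
    by blast+
  define h r where "h = m div 2" and "r = m mod 2"
  have m: "m = 2 * h + r" by (simp add: h_def r_def)
  \<comment> \<open>By \<open>far\<close>, the complement of a facet contains at least two of the
    \<open>yi\<close>; it also contains exactly one of \<open>x1\<close>, \<open>y1\<close>. So
    \<open>v\<close> sums to at least \<open>2 * h + r\<close> over it.\<close>
  define v where "v i = h * of_bool (i \<in> {y1, y2, y3}) + r * of_bool (i \<in> {x1, y1})" for i
  have d: "distinct [x1, y1, x2, y2, x3, y3]"
    using M by (rule matching_distinct)
  have U: "UNIV = {x1, y1, x2, y2, x3, y3}"
    using M by (simp add: matching_def)
  have "m \<le> sum v (-F)" if F: "F \<in> facets \<Delta>" for F
  proof -
    obtain u1 w1 u2 w2 u3 w3 where u: "matching u1 w1 u2 w2 u3 w3"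
      "{u1, w1} = {x1, y1}" "{u2, w2} = {x2, y2}" "{u3, w3} = {x3, y3}"
      "F = {u1, u2, u3}" "-F = {w1, w2, w3}"
      using matching_transversal[OF M facet_triangle[OF F]] by metis
    have "F \<in> \<Delta>" using F by (rule facet_face)
    have "sum v (-F) = v w1 + v w2 + v w3"
      unfolding u(6) using matching_distinct[OF u(1)] by simp
    also have "m \<le> \<dots>"
      using u(2-4) far \<open>F \<in> \<Delta>\<close> d unfolding doubleton_eq_iff u(5) m v_def by auto
    finally show ?thesis .
  qed
  then have "packs \<Delta> m v"
    using assms(1) unfolding symbolic_packs_def by blast
  then obtain Ss where Ss: "length Ss = m" "set Ss \<inter> \<Delta> = {}" "\<And>i. (\<Sum>T\<leftarrow>Ss. of_bool (i \<in> T)) \<le> v i"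
    unfolding packs_def by blast
  have "2 * m = (\<Sum>T\<leftarrow>Ss. 2)"
    using Ss(1) by (simp add: sum_list_triv)
  also have "\<dots> \<le> (\<Sum>T\<leftarrow>Ss. card (UNIV \<inter> T))"
    using Ss(2) small_nonface by (intro sum_list_mono) auto
  also have "\<dots> \<le> sum v UNIV"
    unfolding sum_list_card by (intro sum_mono Ss(3))
  also have "\<dots> = 3 * h + 2 * r"
    unfolding U using d by (auto simp: v_def)
  \<comment> \<open>As \<open>m = 2 * h + r\<close>, this forces \<open>h = 0\<close>, hence
    \<open>m < 2\<close>.\<close>
  finally have "2 * m \<le> 3 * h + 2 * r" .
  moreover have "r < 2" by (simp add: r_def)
  ultimately show False
    using assms(2) m by linarith
qed

text \<open>The facets are among the eight transversals of the matching, viewed as the vertices of a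
  cube. If no two triangles are complementary, opposite vertices are never both facets, while
  \<open>no_centre\<close> puts a facet at distance at most one from every vertex.\<close>

lemma exists_disjoint_triangles:
  assumes "symbolic_packs m" "3 \<le> m"
    and M: "matching a1 b1 a2 b2 a3 b3" and face: "{a1, a2, a3} \<in> \<Delta>"
  shows "\<exists>T\<in>triangles (graph_of \<Delta>). -T \<in> triangles (graph_of \<Delta>)"
proof (rule ccontr)
  assume none: "\<not> ?thesis"
  have d: "distinct [a1, b1, a2, b2, a3, b3]"
    using M by (rule matching_distinct)
  have U: "UNIV = {a1, b1, a2, b2, a3, b3}"
    using M by (simp add: matching_def)
  have tri: "{u, w, z} \<in> triangles (graph_of \<Delta>)" if "{u, w, z} \<in> \<Delta>" "distinct [u, w, z]" for u w z
    using that by (intro facet_triangle) (simp add: facet_iff)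
  have opposite: "\<not> ({u1, u2, u3} \<in> \<Delta> \<and> {w1, w2, w3} \<in> \<Delta>)" if "matching u1 w1 u2 w2 u3 w3" for u1 w1 u2 w2 u3 w3
  proof
    assume "{u1, u2, u3} \<in> \<Delta> \<and> {w1, w2, w3} \<in> \<Delta>"
    moreover have "-{u1, u2, u3} = {w1, w2, w3}"
      using matching_distinct[OF that] that by (auto simp: matching_def)
    ultimately show False
      using none tri[of u1 u2 u3] tri[of w1 w2 w3] matching_distinct[OF that] by auto
  qed
  have swap: "matching b1 a1 a2 b2 a3 b3" "matching a1 b1 b2 a2 a3 b3" "matching a1 b1 a2 b2 b3 a3"
    using M by (auto simp: matching_def insert_commute)
  have opp: "{b1, b2, b3} \<notin> \<Delta>"
    "\<not> ({b1, a2, a3} \<in> \<Delta> \<and> {a1, b2, b3} \<in> \<Delta>)"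
    "\<not> ({a1, b2, a3} \<in> \<Delta> \<and> {b1, a2, b3} \<in> \<Delta>)"
    "\<not> ({a1, a2, b3} \<in> \<Delta> \<and> {b1, b2, a3} \<in> \<Delta>)"
    using opposite[OF M] face opposite[OF swap(1)] opposite[OF swap(2)] opposite[OF swap(3)] by blast+
  \<comment> \<open>Three such facets would make \<open>{b1, b2, b3}\<close> a triangle, although
    not a face, complementary to the facet \<open>{a1, a2, a3}\<close>.\<close>
  have not_all: "\<not> ({a1, b2, b3} \<in> \<Delta> \<and> {b1, a2, b3} \<in> \<Delta> \<and> {b1, b2, a3} \<in> \<Delta>)"
  proof
    assume A: "{a1, b2, b3} \<in> \<Delta> \<and> {b1, a2, b3} \<in> \<Delta> \<and> {b1, b2, a3} \<in> \<Delta>"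
    have "{b2, b3} \<in> \<Delta>" "{b1, b3} \<in> \<Delta>" "{b1, b2} \<in> \<Delta>"
      using A subface[of "{a1, b2, b3}" "{b2, b3}"] subface[of "{b1, a2, b3}" "{b1, b3}"]
        subface[of "{b1, b2, a3}" "{b1, b2}"] by blast+
    then have "{b1, b2, b3} \<in> triangles (graph_of \<Delta>)"
      using d vertex_face by (auto simp: triangle_iff insert_commute)
    moreover have "-{a1, a2, a3} = {b1, b2, b3}"
      using d U by auto
    ultimately show False
      using none tri[OF face] d by auto
  qed
  have facets: "F \<in> {{a1,a2,a3}, {b1,a2,a3}, {a1,b2,a3}, {a1,a2,b3}, {a1,b2,b3}, {b1,a2,b3}, {b1,b2,a3}, {b1,b2,b3}}"
    if F: "F \<in> facets \<Delta>" for F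
  proof -
    obtain u1 w1 u2 w2 u3 w3 where u: "matching u1 w1 u2 w2 u3 w3"
      "{u1, w1} = {a1, b1}" "{u2, w2} = {a2, b2}" "{u3, w3} = {a3, b3}"
      "F = {u1, u2, u3}" "-F = {w1, w2, w3}"
      using matching_transversal[OF M facet_triangle[OF F]] by metis
    from u(2-4) show ?thesis
      unfolding doubleton_eq_iff u(5) by (elim disjE conjE) simp_all
  qed
  have cover: "{b1,a2,a3} \<in> \<Delta> \<or> {b1,a2,b3} \<in> \<Delta> \<or> {b1,b2,a3} \<in> \<Delta>"
    "{a1,b2,a3} \<in> \<Delta> \<or> {a1,b2,b3} \<in> \<Delta> \<or> {b1,b2,a3} \<in> \<Delta>"
    "{a1,a2,b3} \<in> \<Delta> \<or> {a1,b2,b3} \<in> \<Delta> \<or> {b1,a2,b3} \<in> \<Delta>"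
  proof -
    have c: "\<exists>F\<in>\<Delta>. i \<in> F \<and> F \<in> {{a1,a2,a3}, {b1,a2,a3}, {a1,b2,a3}, {a1,a2,b3}, {a1,b2,b3}, {b1,a2,b3}, {b1,b2,a3}}" for i
    proof -
      obtain F where F: "F \<in> facets \<Delta>" "{i} \<subseteq> F"
        using face_subset_facet[OF vertex_face] by metis
      have "F \<in> \<Delta>" using F(1) by (rule facet_face)
      moreover from this opp(1) have "F \<noteq> {b1, b2, b3}" by blast
      ultimately have "F \<in> {{a1,a2,a3}, {b1,a2,a3}, {a1,b2,a3}, {a1,a2,b3}, {a1,b2,b3}, {b1,a2,b3}, {b1,b2,a3}}"
        using facets[OF F(1)] by (simp only: insert_iff empty_iff simp_thms)
      with \<open>F \<in> \<Delta>\<close> F(2) show ?thesis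
        by (intro bexI[of _ F] conjI) simp_all
    qed
    show "{b1,a2,a3} \<in> \<Delta> \<or> {b1,a2,b3} \<in> \<Delta> \<or> {b1,b2,a3} \<in> \<Delta>"
      using c[of b1] d by (elim bexE conjE insertE) auto
    show "{a1,b2,a3} \<in> \<Delta> \<or> {a1,b2,b3} \<in> \<Delta> \<or> {b1,b2,a3} \<in> \<Delta>"
      using c[of b2] d by (elim bexE conjE insertE) auto
    show "{a1,a2,b3} \<in> \<Delta> \<or> {a1,b2,b3} \<in> \<Delta> \<or> {b1,a2,b3} \<in> \<Delta>"
      using c[of b3] d by (elim bexE conjE insertE) auto
  qed
  have "2 \<le> m" using assms(2) by simp
  note centre = no_centre[OF assms(1) this]
  \<comment> \<open>By \<open>centre[OF M]\<close> and \<open>not_all\<close>, one or two of the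
    transversals with exactly two \<open>bj\<close> are facets. If only the one through
    \<open>ai\<close> is, no facet is left for \<open>bi\<close>, since the opposite transversal is
    excluded. If exactly the one through \<open>ai\<close> is missing, all transversals at distance
    at most one from it are excluded, against \<open>no_centre\<close>.\<close>
  show False
    using centre[OF M] centre[OF swap(1)] centre[OF swap(2)] centre[OF swap(3)] opp not_all cover
    by argo
qed

section \<open>The packing property and condition (c)\<close>

lemma condition_of_symbolic_packs:
  assumes "symbolic_packs m" "3 \<le> m"
  shows "(\<exists>e\<^sub>1\<in>complement_graph (graph_of \<Delta>). \<exists>e\<^sub>2\<in>complement_graph (graph_of \<Delta>).
      \<exists>e\<^sub>3\<in>complement_graph (graph_of \<Delta>). e\<^sub>1 \<inter> e\<^sub>2 = {} \<and> e\<^sub>1 \<inter> e\<^sub>3 = {} \<and> e\<^sub>2 \<inter> e\<^sub>3 = {})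
    \<and> (\<exists>T\<^sub>1\<in>triangles (graph_of \<Delta>). \<exists>T\<^sub>2\<in>triangles (graph_of \<Delta>). T\<^sub>1 \<inter> T\<^sub>2 = {})"
proof -
  obtain F where F: "F \<in> facets \<Delta>"
    using face_subset_facet[OF vertex_face] by metis
  obtain a1 b1 a2 b2 a3 b3 where M: "matching a1 b1 a2 b2 a3 b3" "F = {a1, a2, a3}"
    using exists_matching[OF assms F] by metis
  have "{a1, b1} \<in> complement_graph (graph_of \<Delta>)" "{a2, b2} \<in> complement_graph (graph_of \<Delta>)"
    "{a3, b3} \<in> complement_graph (graph_of \<Delta>)"
    "{a1, b1} \<inter> {a2, b2} = {}" "{a1, b1} \<inter> {a3, b3} = {}" "{a2, b2} \<inter> {a3, b3} = {}"
    using M(1) matching_distinct[OF M(1)] unfolding nonedge_iff matching_def by auto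
  moreover obtain T where "T \<in> triangles (graph_of \<Delta>)" "-T \<in> triangles (graph_of \<Delta>)"
    using exists_disjoint_triangles[OF assms M(1)] facet_face[OF F] M(2) by blast
  moreover have "T \<inter> -T = {}" by blast
  ultimately show ?thesis by blast
qed

text \<open>Three disjoint nonedges cover all six vertices and disjoint triangles are complementary,
  so the matching can be oriented with the two triangles as its sides.\<close>

lemma symbolic_packs_of_condition:
  assumes e: "e1 \<in> complement_graph (graph_of \<Delta>)" "e2 \<in> complement_graph (graph_of \<Delta>)"
      "e3 \<in> complement_graph (graph_of \<Delta>)" "e1 \<inter> e2 = {}" "e1 \<inter> e3 = {}" "e2 \<inter> e3 = {}"
    and T: "T1 \<in> triangles (graph_of \<Delta>)" "T2 \<in> triangles (graph_of \<Delta>)" "T1 \<inter> T2 = {}"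
  shows "symbolic_packs m"
proof -
  obtain a1 b1 a2 b2 a3 b3 where ab: "e1 = {a1, b1}" "e2 = {a2, b2}" "e3 = {a3, b3}"
    using e(1-3) unfolding nonedge_iff card_2_iff by metis
  have "card (e1 \<union> e2 \<union> e3) = 6"
    using e by (simp add: nonedge_iff card_Un_disjoint Int_Un_distrib2)
  then have "e1 \<union> e2 \<union> e3 = UNIV"
    using card_vertices by (intro card_subset_eq) auto
  then have M: "matching a1 b1 a2 b2 a3 b3"
    using e(1-3) unfolding matching_def nonedge_iff ab by auto
  have "card T2 = card (-T1)"
    using T(1,2) card_vertices by (simp add: triangle_iff Compl_eq_Diff_UNIV card_Diff_subset)
  then have "T2 = -T1"
    using T(3) by (intro card_subset_eq) auto
  obtain x1 y1 x2 y2 x3 y3 where "matching x1 y1 x2 y2 x3 y3" "T1 = {x1, x2, x3}" "-T1 = {y1, y2, y3}"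
    using matching_transversal[OF M T(1)] by metis
  then show ?thesis
    unfolding symbolic_packs_def
    using packs_of_disjoint_triangles T(1,2) \<open>T2 = -T1\<close> by metis
qed

lemma symbolic_power_eq_iff_packs:
  "symbolic_power \<Delta> m = (ideal_power (stanley_reisner_ideal \<Delta>) m :: ('v, 'k::field) mpoly set) \<longleftrightarrow>
     symbolic_packs m"
  unfolding symbolic_power_eq_iff symbolic_packs_def
  using packs_imp_symbolic complex by blast

end

theorem theorem2p3:
  fixes \<Delta> :: "'v::finite set set"
  assumes "CARD('v) = 6"
    and "simplicial_complex \<Delta>"
    and "pure \<Delta>"
    and "complex_dim \<Delta> = 2"
  shows "((\<exists>m\<ge>3. symbolic_power \<Delta> m = ideal_power (stanley_reisner_ideal \<Delta> :: ('v, 'k::field) mpoly set) m) \<longleftrightarrow>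
          (\<forall>m\<ge>1. symbolic_power \<Delta> m = ideal_power (stanley_reisner_ideal \<Delta> :: ('v, 'k::field) mpoly set) m))
       \<and> ((\<forall>m\<ge>1. symbolic_power \<Delta> m = ideal_power (stanley_reisner_ideal \<Delta> :: ('v, 'k::field) mpoly set) m) \<longleftrightarrow>
          (\<exists>e\<^sub>1 \<in> complement_graph (graph_of \<Delta>). \<exists>e\<^sub>2 \<in> complement_graph (graph_of \<Delta>).
             \<exists>e\<^sub>3 \<in> complement_graph (graph_of \<Delta>).
               e\<^sub>1 \<inter> e\<^sub>2 = {} \<and> e\<^sub>1 \<inter> e\<^sub>3 = {} \<and> e\<^sub>2 \<inter> e\<^sub>3 = {})
          \<and> (\<exists>T\<^sub>1 \<in> triangles (graph_of \<Delta>). \<exists>T\<^sub>2 \<in> triangles (graph_of \<Delta>). T\<^sub>1 \<inter> T\<^sub>2 = {}))"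
    (is "(?a \<longleftrightarrow> ?b) \<and> (?b \<longleftrightarrow> ?c)")
proof -
  interpret complex6 \<Delta>
    using assms card_facet by unfold_locales
  have cond: ?c if "symbolic_packs m" "3 \<le> m" for m
    using that by (rule condition_of_symbolic_packs)
  have packs: "symbolic_packs m" if ?c for m
    using that by (elim conjE bexE) (rule symbolic_packs_of_condition)
  have "(\<exists>m\<ge>3. symbolic_packs m) \<longleftrightarrow> ?c"
  proof
    assume "\<exists>m\<ge>3. symbolic_packs m"
    then obtain m where "symbolic_packs m" "3 \<le> m" by blast
    then show ?c by (rule cond)
  next
    assume ?c
    then have "symbolic_packs 3" by (rule packs)
    then show "\<exists>m\<ge>3. symbolic_packs m" by blast
  qed
  moreover have "(\<forall>m\<ge>1. symbolic_packs m) \<longleftrightarrow> ?c"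
  proof
    assume "\<forall>m\<ge>1. symbolic_packs m"
    then have "symbolic_packs 3" by simp
    then show ?c by (rule cond) simp
  next
    assume ?c
    then show "\<forall>m\<ge>1. symbolic_packs m" by (intro allI impI packs)
  qed
  ultimately show ?thesis
    unfolding symbolic_power_eq_iff_packs by (simp only: simp_thms)
qed

end
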